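(* Let $d\geq 2$, $h\geq 2$ and $g\geq 1$ be integers, and let $m_1,\ldots,m_d$ and $g_1,\ldots,g_d$ be positive integers such that $g_i$ divides $m_i$ for each $i=1,\ldots,d$. Let $\mathcal{A}$ be a $B_h[g]$ set on $(\mathbb{Z}_{m_1}\times\cdots\times\mathbb{Z}_{m_d},+)$. Then $$\mathcal{B}:=\left\{\left(a_1\bmod \tfrac{m_1}{g_1},\ldots,a_d\bmod \tfrac{m_d}{g_d}\right):(a_1,\ldots,a_d)\in\mathcal{A}\right\}$$ is a $B_h[g\,g_1\cdots g_d]$ set on $\left(\mathbb{Z}_{m_1/g_1}\times\cdots\times\mathbb{Z}_{m_d/g_d},+\right)$.
   Context: Let $(G,+)$ be an abelian group, and let $h\ge 2$, $g\ge 1$ be integers. A subset $\mathcal{A}\subseteq G$ is a $B_h[g]$ set on $G$ if every $x\in G$ can be written in at most $g$ ways as a sum of $h$ (not necessarily distinct) elements of $\mathcal{A}$, where representations $x=a_1+\cdots+a_h$ with $a_1,\ldots,a_h\in\mathcal{A}$ that differ only by rearrangement of the summands are counted as the same. $\mathbb{Z}_m$ denotes the additive group of integers modulo $m$; for $g_i\mid m_i$ and $a_i\in\mathbb{Z}_{m_i}$, $a_i\bmod \frac{m_i}{g_i}$ denotes the image of $a_i$ under the reduction map $\mathbb{Z}_{m_i}\to\mathbb{Z}_{m_i/g_i}$. The expression $g\,g_1\cdots g_d$ is the product of these integers. *)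

theory Defs
  imports "HOL-Algebra.Algebra" "HOL-Library.Multiset"
begin

(* HOL-Algebra writes groups multiplicatively, so the "sum" of a list is its product
   in G.  Two representations are identified iff they are rearrangements of each other,
   i.e. iff the lists of summands have the same multiset.  Finiteness is required
   explicitly because card of an infinite set is 0. *)

definition (in comm_group) representations :: "nat \<Rightarrow> 'a set \<Rightarrow> 'a \<Rightarrow> 'a multiset set" where
  "representations h A x =
     mset ` {as. length as = h \<and> set as \<subseteq> A \<and> foldr (\<otimes>) as \<one> = x}"

definition (in comm_group) Bhg_set :: "nat \<Rightarrow> nat \<Rightarrow> 'a set \<Rightarrow> bool" where
  "Bhg_set h g A \<longleftrightarrow> A \<subseteq> carrier G \<and>
     (\<forall>x \<in> carrier G. finite (representations h A x) \<and> card (representations h A x) \<le> g)"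

(* Z_{m 1} x ... x Z_{m d}: elements are functions on {1..d} whose i-th entry is the
   canonical representative in {0..<m i} (for m i > 0). *)

definition zmod_prod :: "nat \<Rightarrow> (nat \<Rightarrow> nat) \<Rightarrow> (nat \<Rightarrow> int) monoid" where
  "zmod_prod d m = product_group {1..d} (\<lambda>i. integer_mod_group (m i))"

lemma comm_group_zmod_prod: "comm_group (zmod_prod d m)"
proof -
  have "group (zmod_prod d m)"
    by (simp add: zmod_prod_def)
  then show ?thesis
  proof (rule group.group_comm_groupI)
    fix x y
    assume "x \<in> carrier (zmod_prod d m)" "y \<in> carrier (zmod_prod d m)"
    then show "x \<otimes>\<^bsub>zmod_prod d m\<^esub> y = y \<otimes>\<^bsub>zmod_prod d m\<^esub> x"
      by (auto simp: zmod_prod_def add.commute intro!: restrict_ext)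
  qed
qed

end

theory Submission
  imports Defs
begin

text \<open>
  Reduction is a homomorphism whose fibres have at most \<open>g\<^sub>1 \<cdots> g\<^sub>d\<close> elements. Lifting the
  summands turns each representation of \<open>x\<close> in the image of \<open>A\<close> into a representation in \<open>A\<close>
  of some element of the fibre over \<open>x\<close>, and each such element has at most \<open>g\<close> of them.
\<close>

text \<open>The two conjuncts are proved together: in the induction step, multiplicativity of
  \<open>h\<close> applies only once the product of the tail is known to lie in the carrier.\<close>

lemma (in group_hom) hom_foldr_mult:
  "set as \<subseteq> carrier G \<Longrightarrow>
    foldr (\<otimes>\<^bsub>G\<^esub>) as \<one>\<^bsub>G\<^esub> \<in> carrier G \<and>
    h (foldr (\<otimes>\<^bsub>G\<^esub>) as \<one>\<^bsub>G\<^esub>) = foldr (\<otimes>\<^bsub>H\<^esub>) (map h as) \<one>\<^bsub>H\<^esub>"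
  by (induction as) auto

text \<open>Separates the counting of representations from modular arithmetic: about the reduction
  map, the theorem then only has to supply that it is a homomorphism and a bound \<open>k\<close> on
  its fibres.\<close>

lemma Bhg_set_hom_image:
  assumes G: "comm_group G" and H: "comm_group H" and f: "f \<in> hom G H"
    and A: "comm_group.Bhg_set G h g A"
    and fibre: "\<And>x. x \<in> carrier H \<Longrightarrow>
      finite {y \<in> carrier G. f y = x} \<and> card {y \<in> carrier G. f y = x} \<le> k"
  shows "comm_group.Bhg_set H h (g * k) (f ` A)"
proof -
  interpret G: comm_group G by fact
  interpret H: comm_group H by fact
  interpret group_hom G H f
    using f by unfold_locales
  have A_carrier: "A \<subseteq> carrier G"
    and A_reps: "\<And>y. y \<in> carrier G \<Longrightarrow> finite (G.representations h A y) \<and>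
      card (G.representations h A y) \<le> g"
    using A unfolding G.Bhg_set_def by auto
  show ?thesis
    unfolding H.Bhg_set_def
  proof (intro conjI ballI)
    show "f ` A \<subseteq> carrier H"
      using A_carrier by auto
    fix x assume x: "x \<in> carrier H"
    define F where "F = {y \<in> carrier G. f y = x}"
    \<comment> \<open>Distinct multisets over \<open>A\<close> may merge under
      \<open>image_mset f\<close>, and different \<open>y\<close> may contribute the same multiset.
      Both only shrink \<open>U\<close>, so a union bound suffices.\<close>
    define U where "U = (\<Union>y\<in>F. image_mset f ` G.representations h A y)"
    have F: "finite F" "card F \<le> k"
      using fibre[OF x] unfolding F_def by auto
    have sub: "H.representations h (f ` A) x \<subseteq> U"
    proof
      fix M assume "M \<in> H.representations h (f ` A) x"
      then obtain bs where bs: "M = mset bs" "length bs = h" "set bs \<subseteq> f ` A"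
        "foldr (\<otimes>\<^bsub>H\<^esub>) bs \<one>\<^bsub>H\<^esub> = x"
        unfolding H.representations_def by auto
      \<comment> \<open>Chooses preimages for all entries of \<open>bs\<close> at once, keeping
        their order and number.\<close>
      then have "bs \<in> map f ` lists A"
        unfolding lists_image[symmetric] by auto
      then obtain as where as: "bs = map f as" "set as \<subseteq> A"
        by auto
      define y where "y = foldr (\<otimes>\<^bsub>G\<^esub>) as \<one>\<^bsub>G\<^esub>"
      have "y \<in> F"
        using hom_foldr_mult[of as] as bs A_carrier unfolding F_def y_def by auto
      moreover have "mset as \<in> G.representations h A y"
        using as bs unfolding G.representations_def y_def by auto
      ultimately show "M \<in> U"
        unfolding U_def using as bs by (auto intro!: bexI[of _ y])
    qed
    have fin: "finite U"
      unfolding U_def using F A_reps by (auto simp: F_def)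
    have "card U \<le> (\<Sum>y\<in>F. card (image_mset f ` G.representations h A y))"
      unfolding U_def using F by (intro card_UN_le)
    also have "\<dots> \<le> (\<Sum>y\<in>F. g)"
    proof (rule sum_mono)
      fix y assume "y \<in> F"
      then have "finite (G.representations h A y)" "card (G.representations h A y) \<le> g"
        using A_reps unfolding F_def by auto
      then show "card (image_mset f ` G.representations h A y) \<le> g"
        using card_image_le order_trans by blast
    qed
    also have "\<dots> \<le> g * k"
      using F by simp
    finally show "card (H.representations h (f ` A) x) \<le> g * k"
      using card_mono[OF fin sub] by linarith
    show "finite (H.representations h (f ` A) x)"
      using finite_subset[OF sub fin] .
  qed
qed

text \<open>Positivity matters because \<open>integer_mod_group 0\<close> is the group of all
  integers.\<close>

lemma carrier_zmod_prod:
  assumes "\<And>i. i \<in> {1..d} \<Longrightarrow> m i > 0"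
  shows "carrier (zmod_prod d m) = (\<Pi>\<^sub>E i\<in>{1..d}. {0..<int (m i)})"
proof -
  have "carrier (integer_mod_group (m i)) = {0..<int (m i)}" if "i \<in> {1..d}" for i
    using assms[OF that] by (simp add: carrier_integer_mod_group)
  then show ?thesis
    unfolding zmod_prod_def carrier_product_group by (intro PiE_cong)
qed

lemma mult_zmod_prod:
  "x \<otimes>\<^bsub>zmod_prod d m\<^esub> y = (\<lambda>i\<in>{1..d}. (x i + y i) mod int (m i))"
  by (simp add: zmod_prod_def)

text \<open>With the remainder fixed, \<open>z\<close> is determined by its quotient
  \<open>z div int n\<close>, which takes at most \<open>k\<close> values. Equality can fail: the
  class is empty if \<open>r\<close> is not a remainder modulo \<open>n\<close>.\<close>

lemma card_residue_class_le:
  fixes n k :: nat and r :: int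
  assumes "n > 0"
  shows "card {z \<in> {0..<int (n * k)}. z mod int n = r} \<le> k"
proof -
  have "{z \<in> {0..<int (n * k)}. z mod int n = r} \<subseteq> (\<lambda>q. q * int n + r) ` {0..<int k}"
  proof
    fix z assume z: "z \<in> {z \<in> {0..<int (n * k)}. z mod int n = r}"
    have "z div int n < int k"
    proof (rule ccontr)
      assume "\<not> z div int n < int k"
      then have "int n * int k \<le> int n * (z div int n)"
        by (intro mult_left_mono) auto
      also have "\<dots> \<le> z"
        using assms mult_div_mod_eq[of "int n" z] pos_mod_sign[of "int n" z] by linarith
      finally show False
        using z by simp
    qed
    moreover have "0 \<le> z div int n"
      using z assms by (simp add: pos_imp_zdiv_nonneg_iff)
    ultimately show "z \<in> (\<lambda>q. q * int n + r) ` {0..<int k}"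
      using z by (intro image_eqI[of _ _ "z div int n"]) (auto simp: div_mult_mod_eq)
  qed
  from surj_card_le[OF _ this] show ?thesis
    by simp
qed

theorem theorem3:
  fixes d h g :: nat
    and m gs :: "nat \<Rightarrow> nat"
    and A B :: "(nat \<Rightarrow> int) set"
  assumes "d \<ge> 2" and "h \<ge> 2" and "g \<ge> 1"
    and "\<And>i. i \<in> {1..d} \<Longrightarrow> m i > 0"
    and "\<And>i. i \<in> {1..d} \<Longrightarrow> gs i > 0"
    and "\<And>i. i \<in> {1..d} \<Longrightarrow> gs i dvd m i"
    and "comm_group.Bhg_set (zmod_prod d m) h g A"
    and "B = {\<lambda>i\<in>{1..d}. a i mod int (m i div gs i) | a. a \<in> A}"
  shows "comm_group.Bhg_set (zmod_prod d (\<lambda>i. m i div gs i)) h (g * (\<Prod>i = 1..d. gs i)) B"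
proof -
  define n where "n = (\<lambda>i. m i div gs i)"
  define f :: "(nat \<Rightarrow> int) \<Rightarrow> nat \<Rightarrow> int" where "f = (\<lambda>a. \<lambda>i\<in>{1..d}. a i mod int (n i))"
  have m: "m i = n i * gs i" if "i \<in> {1..d}" for i
    using assms(6)[OF that] by (simp add: n_def)
  have n_pos: "n i > 0" if "i \<in> {1..d}" for i
    using assms(4)[OF that] m[OF that] by simp
  have carrier_m: "carrier (zmod_prod d m) = (\<Pi>\<^sub>E i\<in>{1..d}. {0..<int (m i)})"
    using assms(4) by (rule carrier_zmod_prod)
  have carrier_n: "carrier (zmod_prod d n) = (\<Pi>\<^sub>E i\<in>{1..d}. {0..<int (n i)})"
    using n_pos by (rule carrier_zmod_prod)
  have "f \<in> hom (zmod_prod d m) (zmod_prod d n)"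
  proof (rule homI)
    show "f a \<in> carrier (zmod_prod d n)" for a
      using n_pos unfolding carrier_n f_def by auto
    \<comment> \<open>Since \<open>n i\<close> divides \<open>m i\<close>, reducing modulo
      \<open>m i\<close> first does not affect the residue modulo \<open>n i\<close>; this makes
      \<open>f\<close> additive.\<close>
    have "(a i + b i) mod int (m i) mod int (n i) = (a i + b i) mod int (n i)"
      if "i \<in> {1..d}" for a b :: "nat \<Rightarrow> int" and i
      using m[OF that] by (intro mod_mod_cancel) simp
    then show "f (a \<otimes>\<^bsub>zmod_prod d m\<^esub> b) = f a \<otimes>\<^bsub>zmod_prod d n\<^esub> f b" for a b
      unfolding f_def mult_zmod_prod by (auto intro!: restrict_ext simp: mod_add_eq)
  qed
  moreover have "finite {y \<in> carrier (zmod_prod d m). f y = x} \<and>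
      card {y \<in> carrier (zmod_prod d m). f y = x} \<le> (\<Prod>i = 1..d. gs i)" for x
  proof -
    \<comment> \<open>The condition \<open>f y = x\<close> splits into one congruence per
      coordinate, so the fibre lies in a box of residue classes whose size is a product.\<close>
    define S where "S = (\<lambda>i. {z \<in> {0..<int (m i)}. z mod int (n i) = x i})"
    have sub: "{y \<in> carrier (zmod_prod d m). f y = x} \<subseteq> (\<Pi>\<^sub>E i\<in>{1..d}. S i)"
      unfolding carrier_m f_def S_def by (auto simp: PiE_iff extensional_def)
    have fin: "finite (\<Pi>\<^sub>E i\<in>{1..d}. S i)"
      unfolding S_def by (intro finite_PiE finite_subset[OF Collect_restrict]) auto
    have "card (\<Pi>\<^sub>E i\<in>{1..d}. S i) = (\<Prod>i = 1..d. card (S i))"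
      by (simp add: card_PiE)
    also have "\<dots> \<le> (\<Prod>i = 1..d. gs i)"
    proof (intro prod_mono conjI)
      show "card (S i) \<le> gs i" if "i \<in> {1..d}" for i
        using card_residue_class_le[OF n_pos[OF that]] unfolding S_def m[OF that] .
    qed simp
    finally show ?thesis
      using finite_subset[OF sub fin] card_mono[OF fin sub] by linarith
  qed
  moreover have "B = f ` A"
    unfolding assms(8) f_def n_def by auto
  ultimately show ?thesis
    using Bhg_set_hom_image[OF comm_group_zmod_prod comm_group_zmod_prod _ assms(7)]
    unfolding n_def by blast
qed

end
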